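(* Let $b\geq 3$ be an integer. Then $$\limsup_{n\to\infty}\frac{\nu_b^*(n)}{\log\log n}\le\frac{1}{\log(\alpha^{-1})},\qquad \alpha=\log_b(b-1).$$ Moreover, if Conjecture B (stated in the context) holds, then $$\limsup_{n\to\infty}\frac{\nu_b^*(n)}{\log\log n}\ge\frac{1}{\log(\beta^{-1})},\qquad \beta=\frac{\log_b 2}{2b}.$$ Here $\log$ denotes the natural logarithm.
   Context: Fix an integer base $b\geq 2$. Every nonnegative integer $n$ has a base-$b$ expansion $n=\sum_{i=0}^k d_ib^i$ with $0\le d_i\le b-1$ and $d_k>0$. The Erdős–Sloane map is $S_b^*(n)=\prod_{0\le i\le k,\ d_i\neq 0} d_i$ (the product of the nonzero base-$b$ digits of $n$). For a map $f$, $f^0(n)=n$, $f^k(n)=f(f^{k-1}(n))$. The persistence $\nu_b^*(n)$ is the smallest $k\ge 0$ such that $(S_b^* )^k(n)$ is a periodic point of $S_b^*$ (the periodic points of $S_b^*$ are exactly the fixed points $1,\dots,b-1$). For a base $q$, a digit $d$ and a positive integer $n$, $\#d(n)_q$ is the number of occurrences of $d$ in the base-$q$ expansion of $n$ and $\#(n)_q$ the number of base-$q$ digits of $n$. Given $\varepsilon>0$, $n$ is $\varepsilon$-equidistributed in base $q$ if $\left|\frac{\#d(n)_q}{\#(n)_q}-\frac1q\right|<\varepsilon$ for every $d\in\{0,\dots,q-1\}$. Conjecture B: For every integer $q>1$, every finite set $F=\{p_1,\dots,p_k\}$ of primes that does not contain all primes dividing $q$, and every positive integer $a$, for every $\varepsilon>0$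 there exists $N$ such that $a\prod_{i=1}^k p_i^{\alpha_i}$ (with nonnegative integers $\alpha_i$) is $\varepsilon$-equidistributed in base $q$ whenever $\alpha_i\ge N$ for some $i$. *)

theory Defs
  imports "HOL-Analysis.Analysis" "HOL-Computational_Algebra.Primes"
begin

text \<open>Base-\<open>b\<close> digits, least significant first and without leading zeros; \<open>0\<close> has no digits.
  Bases below \<open>2\<close> get the empty list only to make the recursion terminate.\<close>

fun digits :: "nat \<Rightarrow> nat \<Rightarrow> nat list" where
  "digits b n = (if b < 2 \<or> n = 0 then [] else n mod b # digits b (n div b))"

declare digits.simps [simp del]

lemma horner_sum_digits: "b \<ge> 2 \<Longrightarrow> horner_sum id b (digits b n) = n"
  by (induction b n rule: digits.induct) (subst digits.simps, auto)

lemma digits_less: "d \<in> set (digits b n) \<Longrightarrow> d < b"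
proof (induction b n rule: digits.induct)
  case (1 b n)
  then show ?case
    by (subst (asm) (2) digits.simps) (auto split: if_splits)
qed

lemma last_digits_pos: "b \<ge> 2 \<Longrightarrow> n > 0 \<Longrightarrow> last (digits b n) > 0"
proof (induction b n rule: digits.induct)
  case (1 b n)
  show ?case
  proof (cases "n < b")
    case True
    with 1 show ?thesis by (simp add: digits.simps[of b n] digits.simps[of b 0])
  next
    case False
    with 1 have "n div b > 0" by (simp add: div_greater_zero_iff)
    with 1 show ?thesis
      by (simp add: digits.simps[of b n]) (simp add: digits.simps[of b "n div b"])
  qed
qed

definition erdos_sloane :: "nat \<Rightarrow> nat \<Rightarrow> nat" where
  "erdos_sloane b n = prod_list (filter (\<lambda>d. d \<noteq> 0) (digits b n))"

definition periodic_point :: "('a \<Rightarrow> 'a) \<Rightarrow> 'a \<Rightarrow> bool" where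
  "periodic_point f x \<longleftrightarrow> (\<exists>m>0. (f ^^ m) x = x)"

definition persistence :: "nat \<Rightarrow> nat \<Rightarrow> nat" where
  "persistence b n = (LEAST k. periodic_point (erdos_sloane b) ((erdos_sloane b ^^ k) n))"

definition equidistributed :: "real \<Rightarrow> nat \<Rightarrow> nat \<Rightarrow> bool" where
  "equidistributed \<epsilon> q n \<longleftrightarrow>
     (\<forall>d<q. \<bar>real (count_list (digits q n) d) / real (length (digits q n)) - 1 / real q\<bar> < \<epsilon>)"

definition conjecture_B :: bool where
  "conjecture_B \<longleftrightarrow>
     (\<forall>(q::nat) (F::nat set) (a::nat).
        q > 1 \<longrightarrow> finite F \<longrightarrow> (\<forall>p\<in>F. prime p) \<longrightarrow> \<not> {p. prime p \<and> p dvd q} \<subseteq> F \<longrightarrow> a > 0 \<longrightarrow>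
        (\<forall>\<epsilon>>0. \<exists>N::nat. \<forall>e::nat \<Rightarrow> nat.
           (\<exists>p\<in>F. e p \<ge> N) \<longrightarrow> equidistributed \<epsilon> q (a * (\<Prod>p\<in>F. p ^ e p))))"

end

theory Submission
  imports Defs "HOL-Real_Asymp.Real_Asymp"
begin

text \<open>Upper bound: \<open>n\<close> has at most \<open>1 + log b n\<close> digits, so one step of the map multiplies \<open>ln n\<close>
  by at most \<open>log b (b - 1)\<close>, up to an additive constant; after
  \<open>ln (ln n) / ln (inverse (log b (b - 1)))\<close> steps the orbit is bounded.

  Lower bound: start at a power of \<open>b - 1\<close>. All numbers in the orbit have only prime factors below
  \<open>b\<close>, and after removal of all factors \<open>b\<close> (trailing zeros) Conjecture B makes them nearly
  equidistributed as long as they are large. So at least a proportion \<open>1 / (2 * b)\<close> of the digits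
  equals \<open>b - 1\<close>; these contribute a factor coprime to \<open>b\<close> to the next number, whose logarithm is
  therefore at least \<open>log b 2 / (2 * b)\<close> times the previous one.\<close>

section \<open>Number of base-\<open>b\<close> digits\<close>

lemma digits_0 [simp]: "digits b 0 = []"
  by (simp add: digits.simps)

lemma digits_pos: "b \<ge> 2 \<Longrightarrow> n > 0 \<Longrightarrow> digits b n = n mod b # digits b (n div b)"
  by (subst digits.simps) auto

lemma length_digits_upper: "b \<ge> 2 \<Longrightarrow> n < b ^ length (digits b n)"
proof (induction b n rule: digits.induct)
  case (1 b n)
  show ?case
  proof (cases "n = 0")
    case False
    with 1 have "n div b < b ^ length (digits b (n div b))" by simp
    then have "n div b + 1 \<le> b ^ length (digits b (n div b))" by simp
    then have "b * (n div b + 1) \<le> b * b ^ length (digits b (n div b))"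
      by (rule mult_left_mono) simp
    moreover have "n < b * (n div b + 1)"
      using 1(2) by (simp add: dividend_less_times_div)
    ultimately show ?thesis using False 1(2) by (simp add: digits_pos)
  qed simp
qed

lemma length_digits_lower: "b \<ge> 2 \<Longrightarrow> n > 0 \<Longrightarrow> b ^ (length (digits b n) - 1) \<le> n"
proof (induction b n rule: digits.induct)
  case (1 b n)
  show ?case
  proof (cases "n < b")
    case False
    with 1 have pos: "n div b > 0" by (simp add: div_greater_zero_iff)
    with 1 have "b ^ (length (digits b (n div b)) - 1) \<le> n div b" by simp
    then have "b * b ^ (length (digits b (n div b)) - 1) \<le> b * (n div b)"
      by (rule mult_left_mono) simp
    also have "\<dots> \<le> n" by simp
    finally show ?thesis using 1 pos
      by (simp add: digits_pos[of b n] digits_pos[of b "n div b"])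
  qed (use 1 in \<open>simp add: digits_pos\<close>)
qed

section \<open>Iterates, periodic points and persistence of the Erdos-Sloane map\<close>

lemma erdos_sloane_0 [simp]: "erdos_sloane b 0 = 1"
  by (simp add: erdos_sloane_def)

lemma erdos_sloane_rec:
  "b \<ge> 2 \<Longrightarrow> n > 0 \<Longrightarrow>
     erdos_sloane b n = (if n mod b = 0 then 1 else n mod b) * erdos_sloane b (n div b)"
  by (simp add: erdos_sloane_def digits_pos)

lemma erdos_sloane_pos: "erdos_sloane b n > 0"
proof -
  have "prod_list (filter (\<lambda>d. d \<noteq> 0) xs) > 0" for xs :: "nat list"
    by (induction xs) auto
  then show ?thesis by (simp add: erdos_sloane_def)
qed

lemma erdos_sloane_funpow_pos: "n > 0 \<Longrightarrow> (erdos_sloane b ^^ k) n > 0"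
  by (cases k) (auto simp: erdos_sloane_pos)

lemma erdos_sloane_fixed: "b \<ge> 2 \<Longrightarrow> n > 0 \<Longrightarrow> n < b \<Longrightarrow> erdos_sloane b n = n"
  by (simp add: erdos_sloane_rec)

text \<open>Splitting off the last digit trades a factor \<open>b\<close> for one of at most
  \<open>b - 1\<close>, and by induction the rest \<open>n div b\<close> does not grow.\<close>

lemma erdos_sloane_less:
  assumes "b \<ge> 2" "n \<ge> b"
  shows "erdos_sloane b n < n"
  using assms(2)
proof (induction n rule: less_induct)
  case (less n)
  define m where "m = n div b"
  have m: "m > 0" "m < n"
    using less.prems assms(1) by (auto simp: m_def div_greater_zero_iff)
  have "erdos_sloane b m \<le> m"
    using less.IH[of m] m erdos_sloane_fixed[of b m] assms(1) by (cases "m < b") auto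
  moreover have "(if n mod b = 0 then 1 else n mod b) \<le> b - 1"
    using assms(1) mod_less_divisor[of b n] by (auto simp del: mod_less_divisor)
  ultimately have
    "(if n mod b = 0 then 1 else n mod b) * erdos_sloane b m \<le> (b - 1) * m"
    by (intro mult_mono) auto
  then have "erdos_sloane b n \<le> (b - 1) * m"
    using assms less.prems erdos_sloane_rec[of b n] unfolding m_def by simp
  also have "\<dots> < b * m" using m assms(1) by simp
  also have "\<dots> \<le> n" by (simp add: m_def)
  finally show ?case .
qed

lemma erdos_sloane_le: "b \<ge> 2 \<Longrightarrow> n > 0 \<Longrightarrow> erdos_sloane b n \<le> n"
  using erdos_sloane_less[of b n] erdos_sloane_fixed[of b n] by (cases "n < b") auto

lemma erdos_sloane_funpow_le: "b \<ge> 2 \<Longrightarrow> n > 0 \<Longrightarrow> (erdos_sloane b ^^ k) n \<le> n"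
proof (induction k)
  case (Suc k)
  then show ?case
    using erdos_sloane_le[OF Suc.prems(1) erdos_sloane_funpow_pos[OF Suc.prems(2), of k b]] by simp
qed simp

text \<open>From \<open>b\<close> on, every step loses at least 1. This crude count serves for the
  bounded tail of an orbit, and to show that the \<open>LEAST\<close> in \<open>persistence\<close>
  is attained.\<close>

lemma erdos_sloane_funpow_less_base:
  "b \<ge> 2 \<Longrightarrow> n > 0 \<Longrightarrow> n \<le> K \<Longrightarrow> (erdos_sloane b ^^ K) n < b"
proof (induction K arbitrary: n)
  case (Suc K)
  show ?case
  proof (cases "n < b")
    case True
    then show ?thesis using erdos_sloane_funpow_le[OF Suc.prems(1,2), of "Suc K"] by linarith
  next
    case False
    then have "erdos_sloane b n \<le> K" using erdos_sloane_less[of b n] Suc.prems by simp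
    then show ?thesis
      using Suc.IH[OF Suc.prems(1) erdos_sloane_pos] by (simp add: funpow_swap1)
  qed
qed simp

text \<open>Iterates never increase, so a return to \<open>n\<close> forces
  \<open>n \<le> erdos_sloane b n\<close>, which contradicts the strict decrease from
  \<open>b\<close> on.\<close>

lemma periodic_point_erdos_sloane_iff:
  assumes "b \<ge> 2" "n > 0"
  shows "periodic_point (erdos_sloane b) n \<longleftrightarrow> n < b"
proof
  assume "n < b"
  then have "(erdos_sloane b ^^ 1) n = n" using assms erdos_sloane_fixed by simp
  then show "periodic_point (erdos_sloane b) n" unfolding periodic_point_def by blast
next
  assume "periodic_point (erdos_sloane b) n"
  then obtain k where "(erdos_sloane b ^^ Suc k) n = n"
    unfolding periodic_point_def by (metis gr0_implies_Suc)
  then have "n \<le> erdos_sloane b n"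
    using erdos_sloane_funpow_le[OF assms(1) erdos_sloane_pos, of k b n] by (simp add: funpow_swap1)
  then show "n < b" using erdos_sloane_less[of b n] assms(1) by (meson not_le)
qed

text \<open>Bounding an orbit is enough: the remaining steps cost only a constant, which is harmless
  for the limit superior.\<close>

lemma persistence_le:
  assumes "b \<ge> 2" "n > 0" "(erdos_sloane b ^^ k) n \<le> K"
  shows "persistence b n \<le> k + K"
proof -
  let ?m = "(erdos_sloane b ^^ k) n"
  have "(erdos_sloane b ^^ K) ?m < b"
    using erdos_sloane_funpow_less_base[OF assms(1) erdos_sloane_funpow_pos[OF assms(2)] assms(3)] .
  then have "(erdos_sloane b ^^ (k + K)) n < b"
    by (simp add: funpow_add add.commute[of k])
  then show ?thesis
    unfolding persistence_def
    using assms periodic_point_erdos_sloane_iff erdos_sloane_funpow_pos by (intro Least_le) blast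
qed

lemma persistence_less_base:
  assumes "b \<ge> 2" "n > 0"
  shows "(erdos_sloane b ^^ persistence b n) n < b"
proof -
  let ?P = "\<lambda>k. periodic_point (erdos_sloane b) ((erdos_sloane b ^^ k) n)"
  have "?P n"
    using erdos_sloane_funpow_less_base[OF assms order_refl] assms
    by (simp add: periodic_point_erdos_sloane_iff erdos_sloane_funpow_pos)
  then have "?P (persistence b n)" unfolding persistence_def by (rule LeastI)
  then show ?thesis using assms by (simp add: periodic_point_erdos_sloane_iff erdos_sloane_funpow_pos)
qed

section \<open>Upper bound for the persistence\<close>

lemma erdos_sloane_le_power: "erdos_sloane b n \<le> (b - 1) ^ length (digits b n)"
proof -
  \<comment> \<open>The condition on \<open>c\<close> excludes nonempty lists of zeros with
    \<open>c = 0\<close>, whose filtered product is 1; for \<open>b < 2\<close> the digit list is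
    empty.\<close>
  have "prod_list (filter (\<lambda>d. d \<noteq> 0) xs) \<le> c ^ length xs"
    if "\<forall>d\<in>set xs. d \<le> c" "c > 0 \<or> xs = []" for c :: nat and xs
    using that
  proof (induction xs)
    case (Cons x xs)
    then have "prod_list (filter (\<lambda>d. d \<noteq> 0) xs) \<le> c ^ length xs" by auto
    moreover have "(if x = 0 then 1 else x) \<le> c" using Cons.prems by auto
    ultimately show ?case using mult_mono[of "if x = 0 then 1 else x" c] by (auto split: if_splits)
  qed simp
  note * = this[of "digits b n" "b - 1"]
  have "b - 1 > 0 \<or> digits b n = []" by (cases "b < 2") (auto simp: digits.simps)
  moreover have "\<forall>d\<in>set (digits b n). d \<le> b - 1" using digits_less by fastforce
  ultimately show ?thesis using * unfolding erdos_sloane_def by blast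
qed

lemma ln_erdos_sloane_le:
  assumes "b \<ge> 2" "n > 0"
  shows "ln (erdos_sloane b n) \<le> log b (real b - 1) * ln n + ln (real b - 1)"
proof -
  let ?l = "length (digits b n)"
  have l: "?l \<ge> 1" using assms by (simp add: digits_pos)
  have "real (b ^ (?l - 1)) \<le> real n"
    using length_digits_lower[OF assms] by (rule of_nat_mono)
  then have "ln (real b ^ (?l - 1)) \<le> ln n"
    using assms by (intro ln_mono) auto
  then have "(real ?l - 1) * ln b \<le> ln n"
    using assms l by (simp add: ln_realpow)
  then have len: "real ?l \<le> ln n / ln b + 1" using assms by (simp add: field_simps)
  have "real (erdos_sloane b n) \<le> (real b - 1) ^ ?l"
    using of_nat_mono[OF erdos_sloane_le_power[of b n], where ?'a = real] assms by simp
  then have "ln (erdos_sloane b n) \<le> ln ((real b - 1) ^ ?l)"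
    using assms erdos_sloane_pos by (intro ln_mono) auto
  also have "\<dots> = real ?l * ln (real b - 1)" using assms by (simp add: ln_realpow)
  also have "\<dots> \<le> (ln n / ln b + 1) * ln (real b - 1)"
    using len assms by (intro mult_right_mono) auto
  also have "\<dots> = log b (real b - 1) * ln n + ln (real b - 1)"
    by (simp add: log_def field_simps)
  finally show ?thesis .
qed

text \<open>This iterates the one-step bound \<open>x \<mapsto> a * x + c\<close>; its fixed point
  \<open>c / (1 - a)\<close> absorbs the accumulated constants, independently of
  \<open>k\<close>.\<close>

lemma ln_erdos_sloane_funpow_le:
  assumes "b \<ge> 3" "n > 0"
  shows "ln ((erdos_sloane b ^^ k) n)
    \<le> log b (real b - 1) ^ k * ln n + ln (real b - 1) / (1 - log b (real b - 1))"
proof (induction k)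
  case 0
  have "log b (real b - 1) < 1" using assms by simp
  then show ?case using assms by simp
next
  case (Suc k)
  define a where "a = log b (real b - 1)"
  define c where "c = ln (real b - 1)"
  have a: "0 < a" "a < 1" using assms by (auto simp: a_def)
  have "ln ((erdos_sloane b ^^ Suc k) n) \<le> a * ln ((erdos_sloane b ^^ k) n) + c"
    using ln_erdos_sloane_le[of b "(erdos_sloane b ^^ k) n"] assms
    by (simp add: a_def c_def erdos_sloane_funpow_pos)
  also have "\<dots> \<le> a * (a ^ k * ln n + c / (1 - a)) + c"
    using Suc a by (simp add: a_def c_def mult_left_mono)
  also have "\<dots> = a ^ Suc k * ln n + c / (1 - a)" using a by (simp add: field_simps)
  finally show ?case by (simp add: a_def c_def)
qed

lemma persistence_upper:
  assumes "b \<ge> 3"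
  obtains C where "\<And>n. n \<ge> 3 \<Longrightarrow>
    persistence b n \<le> ln (ln n) / ln (inverse (log b (real b - 1))) + C"
proof
  define a where "a = log b (real b - 1)"
  \<comment> \<open>Bounds the iterate once \<open>a ^ k * ln n \<le> 1\<close>, independently of
    \<open>n\<close>.\<close>
  define B where "B = nat \<lceil>exp (1 + ln (real b - 1) / (1 - a))\<rceil>"
  have a: "0 < a" "a < 1" using assms by (auto simp: a_def)
  fix n :: nat assume n: "n \<ge> 3"
  have "exp 1 \<le> real n" using n exp_le by linarith
  then have ln_ge: "ln n \<ge> 1" using n by (simp add: ln_ge_iff)
  define x where "x = ln (ln n) / ln (inverse a)"
  have lna: "ln (inverse a) > 0" using a by (simp add: ln_inverse)
  have x: "x \<ge> 0" using ln_ge lna by (simp add: x_def)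
  \<comment> \<open>The least number of steps with \<open>a ^ k * ln n \<le> 1\<close>; rounding
    costs at most one step.\<close>
  define k where "k = nat \<lceil>x\<rceil>"
  have k: "x \<le> k" "k \<le> x + 1" using x unfolding k_def by linarith+
  have "ln (ln n) \<le> k * ln (inverse a)" using k lna by (simp add: x_def field_simps)
  then have "ln (a ^ k * ln n) \<le> 0"
    using a ln_ge by (simp add: ln_mult ln_realpow ln_inverse)
  then have "a ^ k * ln n \<le> 1" using a ln_ge by simp
  then have "ln ((erdos_sloane b ^^ k) n) \<le> 1 + ln (real b - 1) / (1 - a)"
    using ln_erdos_sloane_funpow_le[of b n k] assms n unfolding a_def by simp
  then have "real ((erdos_sloane b ^^ k) n) \<le> exp (1 + ln (real b - 1) / (1 - a))"
    using n erdos_sloane_funpow_pos[of n k b] by (metis exp_le_cancel_iff exp_ln of_nat_0_less_iff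
        less_le_trans zero_less_numeral)
  then have "(erdos_sloane b ^^ k) n \<le> B" unfolding B_def by linarith
  then have "persistence b n \<le> k + B" using persistence_le assms n by simp
  then show "persistence b n \<le> ln (ln n) / ln (inverse (log b (real b - 1))) + (1 + real B)"
    using k unfolding x_def a_def by linarith
qed

section \<open>Trailing zeros, prime factors of the values, and Conjecture B\<close>

lemma erdos_sloane_mult_base_power:
  assumes "b \<ge> 2" "n > 0"
  shows "erdos_sloane b (b ^ m * n) = erdos_sloane b n"
proof (induction m)
  case (Suc m)
  then show ?case
    using assms erdos_sloane_rec[of b "b * (b ^ m * n)"] by (simp add: mult.assoc)
qed simp

text \<open>For \<open>d = b - 1\<close> this yields a factor coprime to \<open>b\<close>, which
  survives the removal of powers of \<open>b\<close>.\<close>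

lemma power_count_dvd_erdos_sloane:
  assumes "d > 0"
  shows "d ^ count_list (digits b n) d dvd erdos_sloane b n"
proof -
  have "d ^ count_list xs d dvd prod_list (filter (\<lambda>d. d \<noteq> 0) xs)" for xs
    using assms by (induction xs) (auto intro: dvd_mult)
  then show ?thesis by (simp add: erdos_sloane_def)
qed

text \<open>A prime dividing the product divides some nonzero digit. Hence prime factors along an
  orbit stay in one finite set, as Conjecture B requires.\<close>

lemma prime_dvd_erdos_sloane_less:
  assumes "prime p" "p dvd erdos_sloane b n"
  shows "p < b"
proof -
  have "\<exists>d\<in>set xs. d \<noteq> 0 \<and> p dvd d"
    if "p dvd prod_list (filter (\<lambda>d. d \<noteq> 0) xs)" for xs
    using that assms(1) by (induction xs) (auto simp: prime_dvd_mult_iff split: if_splits)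
  then obtain d where "d \<in> set (digits b n)" "d \<noteq> 0" "p dvd d"
    using assms(2) unfolding erdos_sloane_def by blast
  then show ?thesis using digits_less[of d b n] dvd_imp_le[of p d] by simp
qed

text \<open>Matches the products in Conjecture B, which run over a fixed set: primes of
  \<open>F\<close> not dividing \<open>n\<close> get exponent 0.\<close>

lemma prod_prime_multiplicity_superset:
  fixes n :: nat
  assumes "finite F" "\<And>p. p \<in> F \<Longrightarrow> prime p" "n > 0" "\<And>p. prime p \<Longrightarrow> p dvd n \<Longrightarrow> p \<in> F"
  shows "n = (\<Prod>p\<in>F. p ^ multiplicity p n)"
proof -
  have "(\<Prod>p\<in>F. p ^ multiplicity p n) = (\<Prod>p\<in>prime_factors n. p ^ multiplicity p n)"
    using assms by (intro prod.mono_neutral_right)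
      (auto simp: in_prime_factors_iff not_dvd_imp_multiplicity_0)
  also have "\<dots> = n" using assms by (simp add: prime_factorization_nat[symmetric])
  finally show ?thesis by simp
qed

text \<open>If \<open>b\<close> does not divide \<open>n\<close>, some prime \<open>p\<close> occurs less often in \<open>n\<close> than in \<open>b\<close>. Then
  \<open>p ^ multiplicity p n\<close> takes only finitely many values and can play the role of \<open>a\<close> in
  Conjecture B, with \<open>F\<close> the set of all other primes up to \<open>b\<close>.\<close>

lemma conjecture_B_smooth_equidistributed:
  assumes "conjecture_B" "b \<ge> 2" "\<epsilon> > 0"
  obtains M where "\<And>n. n \<ge> M \<Longrightarrow> (\<And>p. prime p \<Longrightarrow> p dvd n \<Longrightarrow> p \<le> b) \<Longrightarrow> \<not> b dvd n \<Longrightarrow>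
    equidistributed \<epsilon> b n"
proof -
  define P where "P = {p. prime p \<and> p \<le> b}"
  have P: "finite P" "\<And>p. p \<in> P \<Longrightarrow> prime p" by (auto simp: P_def)
  have "\<exists>N. \<forall>e. (\<exists>q\<in>P - {p}. e q \<ge> N) \<longrightarrow>
      equidistributed \<epsilon> b (p ^ j * (\<Prod>q\<in>P - {p}. q ^ e q))"
    if "prime p" "p dvd b" for p j :: nat
  proof -
    \<comment> \<open>The prime divisor \<open>p\<close> of \<open>b\<close> is missing from
      \<open>P - {p}\<close>, so Conjecture B applies with \<open>a = p ^ j\<close>.\<close>
    have "\<not> {q. prime q \<and> q dvd b} \<subseteq> P - {p}" using that by auto
    moreover have "p ^ j > 0" using that prime_gt_0_nat by simp
    ultimately show ?thesis
      using assms P unfolding conjecture_B_def by simp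
  qed
  then obtain N where N: "\<And>p j e. prime p \<Longrightarrow> p dvd b \<Longrightarrow> \<exists>q\<in>P - {p}. e q \<ge> N p j \<Longrightarrow>
      equidistributed \<epsilon> b (p ^ j * (\<Prod>q\<in>P - {p}. q ^ e q))"
    by metis
  \<comment> \<open>One threshold for all \<open>p\<close> and \<open>j\<close> up to
    \<open>b\<close>; the summand \<open>b\<close> lets \<open>K\<close> dominate the exponent of
    \<open>p\<close> itself as well.\<close>
  define K where "K = b + (\<Sum>p\<le>b. \<Sum>j\<le>b. N p j)"
  have N_le: "N p j \<le> K" if "p \<le> b" "j \<le> b" for p j
  proof -
    have "N p j \<le> (\<Sum>j\<le>b. N p j)" using that by (intro member_le_sum) auto
    also have "\<dots> \<le> (\<Sum>p\<le>b. \<Sum>j\<le>b. N p j)"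
      using that by (intro member_le_sum[where f = "\<lambda>p. \<Sum>j\<le>b. N p j"]) auto
    finally show ?thesis by (simp add: K_def)
  qed
  show ?thesis
  proof
    fix n
    assume n: "n \<ge> (\<Prod>p\<in>P. p ^ K) + 1" and smooth: "\<And>p. prime p \<Longrightarrow> p dvd n \<Longrightarrow> p \<le> b"
      and ndvd: "\<not> b dvd n"
    have n0: "n > 0" using n by simp
    have n_eq: "n = (\<Prod>p\<in>P. p ^ multiplicity p n)"
    proof (rule prod_prime_multiplicity_superset[OF P n0])
      show "p \<in> P" if "prime p" "p dvd n" for p using that smooth by (simp add: P_def)
    qed
    have "\<exists>p. prime p \<and> multiplicity p n < multiplicity p b"
    proof (rule ccontr)
      assume "\<not> ?thesis"
      then have "b dvd n" using assms(2) by (intro multiplicity_le_imp_dvd) (auto simp: not_less)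
      then show False using ndvd by simp
    qed
    then obtain p where p: "prime p" "multiplicity p n < multiplicity p b" by blast
    have p_dvd: "p dvd b" using p not_dvd_imp_multiplicity_0[of p b] by fastforce
    then have pP: "p \<in> P" "p \<le> b" using p assms(2) dvd_imp_le[of p b] by (auto simp: P_def)
    \<comment> \<open>The exponent of \<open>p\<close> in \<open>n\<close> is thus at most
      \<open>b\<close>, so finitely many instances of Conjecture B suffice.\<close>
    have "multiplicity p b < 2 ^ multiplicity p b" by simp
    also have "\<dots> \<le> p ^ multiplicity p b" using prime_ge_2_nat[OF p(1)] by (simp add: power_mono)
    also have "\<dots> \<le> b" using assms(2) by (intro dvd_imp_le multiplicity_dvd) auto
    finally have j: "multiplicity p n \<le> b" using p by simp
    \<comment> \<open>Otherwise all exponents are at most \<open>K\<close>, and \<open>n\<close>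
      could not exceed the product of all \<open>p ^ K\<close>.\<close>
    have "\<exists>q\<in>P - {p}. multiplicity q n \<ge> K"
    proof (rule ccontr)
      assume neg: "\<not> ?thesis"
      have "multiplicity q n \<le> K" if "q \<in> P" for q
      proof (cases "q = p")
        case False
        with that have "q \<in> P - {p}" by simp
        with neg show ?thesis using nat_le_linear by blast
      qed (use j in \<open>simp add: K_def\<close>)
      then have "(\<Prod>p\<in>P. p ^ multiplicity p n) \<le> (\<Prod>p\<in>P. p ^ K)"
        using P prime_ge_1_nat by (intro prod_mono) (auto intro!: power_increasing)
      then show False using n n_eq by linarith
    qed
    then have "\<exists>q\<in>P - {p}. multiplicity q n \<ge> N p (multiplicity p n)"
      using N_le[OF pP(2) j] order_trans by blast
    from N[OF p(1) p_dvd this] show "equidistributed \<epsilon> b n"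
      using n_eq prod.remove[OF P(1) pP(1), of "\<lambda>p. p ^ multiplicity p n"] by simp
  qed
qed

section \<open>Lower bound for the persistence\<close>

lemma erdos_sloane_reduced_lower:
  assumes "b \<ge> 3" "n > 0" "equidistributed (1 / (2 * real b)) b n"
  obtains m n' where "erdos_sloane b n = b ^ m * n'" "\<not> b dvd n'" "n' > 0"
    "\<And>p. prime p \<Longrightarrow> p dvd n' \<Longrightarrow> p \<le> b" "ln n' \<ge> log b 2 / (2 * real b) * ln n"
proof -
  define s where "s = erdos_sloane b n"
  define c where "c = count_list (digits b n) (b - 1)"
  define l where "l = length (digits b n)"
  have s0: "s > 0" by (simp add: s_def erdos_sloane_pos)
  \<comment> \<open>\<open>b\<close> may be composite: \<open>multiplicity b s\<close> is the
    largest exponent \<open>m\<close> with \<open>b ^ m dvd s\<close>.\<close>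
  obtain n' where n': "s = b ^ multiplicity b s * n'" "\<not> b dvd n'"
    using multiplicity_decompose'[of s b] s0 assms(1) by auto
  have n'0: "n' > 0" using n'(1) s0 by (cases n') auto
  \<comment> \<open>Consecutive integers are coprime, so the factor from the digits
    \<open>b - 1\<close> lies entirely in \<open>n'\<close>.\<close>
  have cop: "coprime ((b - 1) ^ c) (b ^ multiplicity b s)"
    using assms(1) coprime_diff_one_left_nat[of b] by simp
  have "(b - 1) ^ c dvd s"
    using power_count_dvd_erdos_sloane[of "b - 1" b n] assms(1) by (simp add: c_def s_def)
  then have "(b - 1) ^ c dvd n'"
    using cop n'(1) by (metis coprime_dvd_mult_right_iff)
  then have "(b - 1) ^ c \<le> n'" using n'0 by (rule dvd_imp_le)
  \<comment> \<open>Weakening \<open>b - 1\<close> to 2 is the source of \<open>log b 2\<close> in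
    the constant.\<close>
  moreover have "2 ^ c \<le> (b - 1) ^ c" using assms(1) by (intro power_mono) auto
  ultimately have "real (2 ^ c) \<le> real n'" by (intro of_nat_mono) linarith
  then have "ln (2 ^ c) \<le> ln (real n')" by (intro ln_mono) auto
  then have ge: "real c * ln 2 \<le> ln n'" by (simp add: ln_realpow)
  have l: "l > 0" using assms by (simp add: l_def digits_pos)
  \<comment> \<open>The tolerance leaves at least half of the expected frequency
    \<open>1 / b\<close>; hence the factor \<open>1 / (2 * b)\<close>.\<close>
  have "\<bar>real c / real l - 1 / b\<bar> < 1 / (2 * real b)"
    using assms(1,3) unfolding equidistributed_def c_def l_def by simp
  then have "real c / real l > 1 / b - 1 / (2 * real b)" by linarith
  then have "real c / real l > 1 / (2 * real b)" using assms(1) by (simp add: field_simps)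
  then have c: "real c \<ge> real l / (2 * real b)" using l by (simp add: field_simps)
  have "real n \<le> real (b ^ l)"
    using length_digits_upper[of b n] assms(1) unfolding l_def by (intro of_nat_mono) simp
  then have "ln n \<le> ln (real b ^ l)" using assms by (intro ln_mono) auto
  then have "ln n \<le> l * ln b" using assms(1) by (simp add: ln_realpow)
  then have "ln n / ln b \<le> l" using assms(1) by (simp add: field_simps)
  then have "ln n / ln b * (ln 2 / (2 * real b)) \<le> l * (ln 2 / (2 * real b))"
    by (intro mult_right_mono) auto
  also have "\<dots> \<le> c * ln 2" using mult_right_mono[OF c, of "ln 2"] by simp
  finally have "log b 2 / (2 * real b) * ln n \<le> ln n'"
    using ge by (simp add: log_def field_simps)
  moreover have "p \<le> b" if "prime p" "p dvd n'" for p
    using prime_dvd_erdos_sloane_less[OF that(1), of b n] that(2) n'(1)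
    by (metis dvd_mult less_imp_le s_def)
  ultimately show ?thesis using that[of "multiplicity b s" n'] n' n'0 by (simp add: s_def)
qed

lemma log_2_div_bounds:
  fixes b :: nat
  assumes "b \<ge> 2"
  shows "0 < log b 2 / (2 * real b)" "log b 2 / (2 * real b) < 1"
proof -
  have "log b 2 \<le> 1" using assms by simp
  also have "1 < 2 * real b" using assms by simp
  finally show "log b 2 / (2 * real b) < 1" using assms by simp
qed (use assms in simp)

text \<open>Trailing zeros do not affect the next product, so the reduced part \<open>n'\<close> can
  replace the orbit element at each step.\<close>

lemma erdos_sloane_funpow_reduced_lower:
  fixes b M n :: nat
  defines "\<beta> \<equiv> log b 2 / (2 * real b)"
  assumes b: "b \<ge> 3"
    and M: "\<And>m. m \<ge> M \<Longrightarrow> (\<And>p. prime p \<Longrightarrow> p dvd m \<Longrightarrow> p \<le> b) \<Longrightarrow> \<not> b dvd m \<Longrightarrow>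
      equidistributed (1 / (2 * real b)) b m"
    and n: "n > 0" "\<And>p. prime p \<Longrightarrow> p dvd n \<Longrightarrow> p \<le> b" "\<not> b dvd n"
    and large: "real M \<le> exp (\<beta> ^ k * ln n)"
  shows "\<exists>m n'. (erdos_sloane b ^^ k) n = b ^ m * n' \<and> \<not> b dvd n' \<and> n' > 0 \<and>
    (\<forall>p. prime p \<longrightarrow> p dvd n' \<longrightarrow> p \<le> b) \<and> ln n' \<ge> \<beta> ^ k * ln n"
  using large
proof (induction k)
  case 0
  show ?case using n by (intro exI[of _ 0] exI[of _ n]) auto
next
  case (Suc k)
  have \<beta>: "\<beta> \<ge> 0" "\<beta> \<le> 1" using log_2_div_bounds[of b] b by (auto simp: \<beta>_def)
  \<comment> \<open>The lower bounds decrease in \<open>k\<close>, so largeness at the last step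
    gives it at all earlier ones.\<close>
  have "\<beta> ^ Suc k * ln n \<le> \<beta> ^ k * ln n"
    using \<beta> n(1) by (intro mult_right_mono power_decreasing) auto
  then have Mk: "real M \<le> exp (\<beta> ^ k * ln n)" using Suc.prems by (meson exp_le_cancel_iff order_trans)
  obtain m n' where n': "(erdos_sloane b ^^ k) n = b ^ m * n'" "\<not> b dvd n'" "n' > 0"
    "\<And>p. prime p \<Longrightarrow> p dvd n' \<Longrightarrow> p \<le> b" "ln n' \<ge> \<beta> ^ k * ln n"
    using Suc.IH[OF Mk] by blast
  have "real M \<le> exp (ln n')" using Mk n'(5) by (meson exp_le_cancel_iff order_trans)
  then have "M \<le> n'" using n'(3) by simp
  then have "equidistributed (1 / (2 * real b)) b n'" using M n' by blast
  then obtain m' n'' where n'': "erdos_sloane b n' = b ^ m' * n''" "\<not> b dvd n''" "n'' > 0"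
    "\<And>p. prime p \<Longrightarrow> p dvd n'' \<Longrightarrow> p \<le> b" "ln n'' \<ge> \<beta> * ln n'"
    using erdos_sloane_reduced_lower[OF b n'(3)] unfolding \<beta>_def by blast
  have "\<beta> * ln n' \<ge> \<beta> * (\<beta> ^ k * ln n)" using \<beta> n'(5) by (intro mult_left_mono)
  then have "ln n'' \<ge> \<beta> ^ Suc k * ln n" using n''(5) by (simp add: mult.assoc)
  moreover have "(erdos_sloane b ^^ Suc k) n = b ^ m' * n''"
    using n'(1,3) n''(1) b by (simp add: erdos_sloane_mult_base_power)
  ultimately show ?case using n'' by blast
qed

text \<open>While \<open>\<beta> ^ k * ln n\<close> is at least a constant \<open>A\<close>, the
  \<open>k\<close>-th iterate is at least \<open>b\<close>, hence not periodic. So at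
  \<open>k = persistence b n\<close> this quantity has dropped below \<open>A\<close>.\<close>

lemma persistence_lower:
  assumes "conjecture_B" "b \<ge> 3"
  obtains C where "\<And>n. n > 1 \<Longrightarrow> (\<And>p. prime p \<Longrightarrow> p dvd n \<Longrightarrow> p \<le> b) \<Longrightarrow> \<not> b dvd n \<Longrightarrow>
    persistence b n \<ge> ln (ln n) / ln (inverse (log b 2 / (2 * real b))) - C"
proof -
  define \<beta> where "\<beta> = log b 2 / (2 * real b)"
  have \<beta>: "\<beta> > 0" "\<beta> < 1" using log_2_div_bounds[of b] assms(2) by (auto simp: \<beta>_def)
  have lnb: "ln (inverse \<beta>) > 0" using \<beta> by (simp add: ln_inverse)
  obtain M where M: "\<And>m. m \<ge> M \<Longrightarrow> (\<And>p. prime p \<Longrightarrow> p dvd m \<Longrightarrow> p \<le> b) \<Longrightarrow> \<not> b dvd m \<Longrightarrow>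
      equidistributed (1 / (2 * real b)) b m"
    using conjecture_B_smooth_equidistributed[OF assms(1), of b "1 / (2 * real b)"] assms(2) by auto
  \<comment> \<open>\<open>M\<close> makes equidistribution available; \<open>b\<close> keeps the
    iterate away from the periodic points.\<close>
  define A where "A = ln (real (max M b))"
  have A: "A > 0" using assms(2) by (simp add: A_def)
  have expA: "exp A = max M b" using assms(2) by (simp add: A_def)
  show ?thesis
  proof
    fix n
    assume n: "n > 1" "\<And>p. prime p \<Longrightarrow> p dvd n \<Longrightarrow> p \<le> b" "\<not> b dvd n"
    define k where "k = persistence b n"
    have lnn: "ln n > 0" using n by simp
    have "\<not> A \<le> \<beta> ^ k * ln n"
    proof
      assume *: "A \<le> \<beta> ^ k * ln n"
      then have "exp A \<le> exp (\<beta> ^ k * ln n)" by simp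
      then have "real M \<le> exp (\<beta> ^ k * ln n)" using expA by simp
      then obtain m n' where n': "(erdos_sloane b ^^ k) n = b ^ m * n'" "n' > 0"
          "ln n' \<ge> \<beta> ^ k * ln n"
        using erdos_sloane_funpow_reduced_lower[of b M n k, OF assms(2) M _ n(2,3)] n(1)
        unfolding \<beta>_def by auto
      have "exp A \<le> exp (ln n')" using * n'(3) by simp
      then have "b \<le> n'" using expA n'(2) by simp
      also have "\<dots> \<le> b ^ m * n'" using assms(2) by simp
      finally show False
        using n'(1) persistence_less_base[of b n] n assms(2) by (simp add: k_def)
    qed
    then have "ln (\<beta> ^ k * ln n) \<le> ln A" using \<beta> lnn by (intro ln_mono) auto
    then have "ln (ln n) - ln A \<le> k * ln (inverse \<beta>)"
      using \<beta> lnn by (simp add: ln_mult ln_realpow ln_inverse)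
    then have "(ln (ln n) - ln A) / ln (inverse \<beta>) \<le> k" using lnb by (simp add: field_simps)
    then show "persistence b n \<ge>
        ln (ln n) / ln (inverse (log b 2 / (2 * real b))) - ln A / ln (inverse \<beta>)"
      by (simp add: k_def \<beta>_def diff_divide_distrib)
  qed
qed

section \<open>Passage to the limit superior\<close>

lemma tendsto_affine_loglog_quotient:
  "((\<lambda>n. ereal ((ln (ln (real n)) / c + C) / ln (ln (real n)))) \<longlongrightarrow> ereal (1 / c)) sequentially"
proof -
  have "((\<lambda>n. 1 / c + C / ln (ln (real n))) \<longlongrightarrow> 1 / c) sequentially"
    by real_asymp
  moreover have "\<forall>\<^sub>F n in sequentially. ln (ln (real n)) > 0" by real_asymp
  then have "\<forall>\<^sub>F n in sequentially. 1 / c + C / ln (ln (real n)) =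
      (ln (ln (real n)) / c + C) / ln (ln (real n))"
    by eventually_elim (simp add: add_divide_distrib)
  ultimately have "((\<lambda>n. (ln (ln (real n)) / c + C) / ln (ln (real n))) \<longlongrightarrow> 1 / c) sequentially"
    by (rule Lim_transform_eventually)
  then show ?thesis by simp
qed

theorem theorem6:
  fixes b :: nat
  assumes "b \<ge> 3"
  shows "limsup (\<lambda>n. ereal (real (persistence b n) / ln (ln (real n))))
           \<le> ereal (1 / ln (inverse (log (real b) (real b - 1)))) \<and>
         (conjecture_B \<longrightarrow>
           limsup (\<lambda>n. ereal (real (persistence b n) / ln (ln (real n))))
             \<ge> ereal (1 / ln (inverse (log (real b) 2 / (2 * real b)))))"
proof (intro conjI impI)
  let ?f = "\<lambda>n. ereal (real (persistence b n) / ln (ln (real n)))"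
  have loglog_pos: "\<forall>\<^sub>F n in sequentially. ln (ln (real n)) > 0" by real_asymp
  {
    let ?c = "ln (inverse (log (real b) (real b - 1)))"
    obtain C where C: "\<And>n. n \<ge> 3 \<Longrightarrow> persistence b n \<le> ln (ln n) / ?c + C"
      using persistence_upper[OF assms] by blast
    let ?g = "\<lambda>n. ereal ((ln (ln (real n)) / ?c + C) / ln (ln (real n)))"
    have "\<forall>\<^sub>F n in sequentially. ?f n \<le> ?g n"
      using loglog_pos eventually_ge_at_top[of 3]
    proof eventually_elim
      case (elim n)
      then show ?case using C[of n] by (simp add: divide_right_mono)
    qed
    then have "limsup ?f \<le> limsup ?g" by (rule Limsup_mono)
    also have "limsup ?g = ereal (1 / ?c)"
      by (rule lim_imp_Limsup[OF sequentially_bot tendsto_affine_loglog_quotient])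
    finally show "limsup ?f \<le> ereal (1 / ?c)" .
  next
    assume conjB: "conjecture_B"
    let ?c = "ln (inverse (log (real b) 2 / (2 * real b)))"
    obtain C where C: "\<And>n. n > 1 \<Longrightarrow> (\<And>p. prime p \<Longrightarrow> p dvd n \<Longrightarrow> p \<le> b) \<Longrightarrow> \<not> b dvd n \<Longrightarrow>
        persistence b n \<ge> ln (ln n) / ?c - C"
      using persistence_lower[OF conjB assms] by blast
    let ?g = "\<lambda>n. ereal ((ln (ln (real n)) / ?c + (- C)) / ln (ln (real n)))"
    \<comment> \<open>Powers of \<open>b - 1\<close> are coprime to \<open>b\<close> and have only
      prime factors below \<open>b\<close>, so the lower bound holds along this subsequence; that
      suffices for a limit superior.\<close>
    define r where "r = (\<lambda>t::nat. (b - 1) ^ t)"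
    have r: "strict_mono r"
      unfolding r_def using assms by (intro strict_monoI power_strict_increasing) auto
    have r_ge: "persistence b (r t) \<ge> ln (ln (r t)) / ?c - C" if "t > 0" for t
    proof (rule C)
      show "r t > 1" unfolding r_def using that assms by (intro one_less_power) auto
      show "p \<le> b" if "prime p" "p dvd r t" for p
        using prime_dvd_power[OF that(1), of "b - 1" t] that(2) dvd_imp_le[of p "b - 1"] assms
        by (simp add: r_def)
      have "coprime b (r t)"
        using assms coprime_diff_one_right_nat[of b] by (simp add: r_def)
      then show "\<not> b dvd r t" using assms coprime_absorb_left[of b "r t"] by auto
    qed
    have "\<forall>\<^sub>F t in sequentially. ln (ln (real (r t))) > 0"
      using loglog_pos filterlim_subseq[OF r] by (rule eventually_compose_filterlim)
    then have "\<forall>\<^sub>F t in sequentially. (?g \<circ> r) t \<le> (?f \<circ> r) t"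
      using eventually_gt_at_top[of 0]
    proof eventually_elim
      case (elim t)
      then show ?case using r_ge[of t] by (simp add: divide_right_mono)
    qed
    then have "limsup (?g \<circ> r) \<le> limsup (?f \<circ> r)" by (rule Limsup_mono)
    then have "limsup (?g \<circ> r) \<le> limsup ?f"
      using limsup_subseq_mono[OF r, of ?f] by (rule order_trans)
    moreover have "limsup (?g \<circ> r) = ereal (1 / ?c)"
      by (rule lim_imp_Limsup[OF sequentially_bot LIMSEQ_subseq_LIMSEQ[OF tendsto_affine_loglog_quotient r]])
    ultimately show "limsup ?f \<ge> ereal (1 / ?c)" by simp
  }
qed

end
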